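(* Let $m\ge1$ and $k\ge0$ be integers, $0<\theta\le1$, and $\lambda>0$. Then $$\operatorname{Bin}\Big(k\,\Big|\,m,\,1-\exp\Big(-\frac{\lambda\theta}{m}\Big)\Big)=\sum_{r=0}^{\infty}\operatorname{Pois}(r\mid\lambda)\cdot\operatorname{Occ}(k\mid r,m,\theta).$$ Equivalently, for every $0<\gamma<1$, $$\operatorname{Bin}(k\mid m,\gamma)=\sum_{r=0}^{\infty}\operatorname{Pois}\Big(r\,\Big|\,m\cdot\frac{|\ln(1-\gamma)|}{\theta}\Big)\cdot\operatorname{Occ}(k\mid r,m,\theta).$$
   Context: Noncentral Stirling numbers of the second kind: for an integer $n\ge0$ and real $\phi$, the numbers $S(n,k,\phi)$, $0\le k\le n$, are defined by the polynomial identity $(x+\phi)^n=\sum_{k=0}^n S(n,k,\phi)(x)_k$, where $(x)_k=\prod_{i=0}^{k-1}(x-i)$; $S(n,k,\phi)=0$ for $k>n$. Extended occupancy distribution: for integers $n\ge0$, $m\ge1$, $k\ge0$ and $0<\theta\le1$, $\operatorname{Occ}(k\mid n,m,\theta)=\frac{\theta^n}{m^n}(m)_k\,S\big(n,k,m\tfrac{1-\theta}{\theta}\big)$. $\operatorname{Bin}(k\mid m,p)=\binom mk p^k(1-p)^{m-k}$ (zero for $k>m$); $\operatorname{Pois}(r\mid\lambda)=e^{-\lambda}\lambda^r/r!$. *)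

theory Defs
  imports "HOL-Probability.Probability" "HOL-Computational_Algebra.Polynomial"
begin

definition ffact :: "'a::comm_ring_1 \<Rightarrow> nat \<Rightarrow> 'a" where
  "ffact x k = (\<Prod>i<k. x - of_nat i)"

(* [:phi, 1:] is the polynomial x + phi and [:0, 1:] is x; the coefficient sequence is unique by
   is_nc_stirling2_row_ex1 below. *)
definition is_nc_stirling2_row :: "nat \<Rightarrow> real \<Rightarrow> (nat \<Rightarrow> real) \<Rightarrow> bool" where
  "is_nc_stirling2_row n \<phi> S \<longleftrightarrow>
     [:\<phi>, 1:] ^ n = (\<Sum>k\<le>n. smult (S k) (ffact [:0, 1:] k)) \<and> (\<forall>k>n. S k = 0)"

definition nc_stirling2 :: "nat \<Rightarrow> nat \<Rightarrow> real \<Rightarrow> real" where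
  "nc_stirling2 n k \<phi> = (THE S. is_nc_stirling2_row n \<phi> S) k"

definition occ :: "nat \<Rightarrow> nat \<Rightarrow> nat \<Rightarrow> real \<Rightarrow> real" where
  "occ k n m \<theta> =
     \<theta> ^ n / real m ^ n * ffact (real m) k * nc_stirling2 n k (real m * ((1 - \<theta>) / \<theta>))"

lemma ffact_Suc: "ffact x (Suc k) = ffact x k * (x - of_nat k)"
  by (simp add: ffact_def)

lemma poly_ffact: "poly (ffact [:0, 1:] k) x = ffact (x::real) k"
  by (simp add: ffact_def poly_prod)

lemma ffact_of_nat_eq_0: "n < k \<Longrightarrow> ffact (real n) k = 0"
  by (auto simp: ffact_def)

lemma ffact_of_nat_neq_0: "ffact (real n) n \<noteq> 0"
  by (auto simp: ffact_def)

lemma is_nc_stirling2_row_Suc: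
  assumes "is_nc_stirling2_row n \<phi> S"
  shows "is_nc_stirling2_row (Suc n) \<phi>
           (\<lambda>k. (\<phi> + real k) * S k + (case k of 0 \<Rightarrow> 0 | Suc j \<Rightarrow> S j))"
proof -
  let ?X = "[:0, 1:] :: real poly"
  have S0: "S k = 0" if "k > n" for k
    using assms that by (simp add: is_nc_stirling2_row_def)
  have step: "[:\<phi>, 1:] * ffact ?X k = smult (\<phi> + real k) (ffact ?X k) + ffact ?X (Suc k)" for k
  proof -
    have "[:\<phi>, 1:] = [:\<phi> + real k:] + (?X - of_nat k)"
      by (simp add: of_nat_poly)
    then have "[:\<phi>, 1:] * ffact ?X k = ([:\<phi> + real k:] + (?X - of_nat k)) * ffact ?X k"
      by simp
    also have "\<dots> = smult (\<phi> + real k) (ffact ?X k) + ffact ?X (Suc k)"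
      proof -
      have "[:\<phi> + real k:] * ffact ?X k = smult (\<phi> + real k) (ffact ?X k)"
        by simp
      then show ?thesis
        by (simp only: ffact_Suc distrib_right mult.commute[of "?X - of_nat k"])
    qed
    finally show ?thesis .
  qed
  have "[:\<phi>, 1:] ^ Suc n = (\<Sum>k\<le>n. smult (S k) ([:\<phi>, 1:] * ffact ?X k))"
    using assms by (simp add: is_nc_stirling2_row_def sum_distrib_left)
  also have "\<dots> = (\<Sum>k\<le>n. smult ((\<phi> + real k) * S k) (ffact ?X k))
      + (\<Sum>k\<le>n. smult (S k) (ffact ?X (Suc k)))"
    by (simp only: step smult_add_right smult_smult sum.distrib mult.commute)
  also have "(\<Sum>k\<le>n. smult ((\<phi> + real k) * S k) (ffact ?X k))
      = (\<Sum>k\<le>Suc n. smult ((\<phi> + real k) * S k) (ffact ?X k))"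
    by (simp add: S0)
  also have "(\<Sum>k\<le>n. smult (S k) (ffact ?X (Suc k)))
      = (\<Sum>k\<le>Suc n. smult (case k of 0 \<Rightarrow> 0 | Suc j \<Rightarrow> S j) (ffact ?X k))"
    by (subst sum.atMost_Suc_shift) simp
  finally show ?thesis
    by (auto simp: is_nc_stirling2_row_def smult_add_left sum.distrib S0 split: nat.splits)
qed

lemma is_nc_stirling2_row_unique:
  assumes S: "is_nc_stirling2_row n \<phi> S" and T: "is_nc_stirling2_row n \<phi> T"
  shows "S = T"
proof
  fix k
  have eq: "(\<Sum>j\<le>n. (S j - T j) * ffact x j) = 0" for x
  proof -
    have "(\<Sum>j\<le>n. smult (S j) (ffact [:0, 1:] j)) = (\<Sum>j\<le>n. smult (T j) (ffact [:0, 1:] j))"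
      using S T by (simp add: is_nc_stirling2_row_def)
    then have "poly (\<Sum>j\<le>n. smult (S j) (ffact [:0, 1:] j)) x
        = poly (\<Sum>j\<le>n. smult (T j) (ffact [:0, 1:] j)) x"
      by simp
    then show ?thesis
      by (simp add: poly_sum poly_ffact left_diff_distrib sum_subtractf)
  qed
  show "S k = T k"
  proof (induction k rule: less_induct)
    case (less k)
    show ?case
    proof (cases "k \<le> n")
      case True
      have "(\<Sum>j\<le>n. (S j - T j) * ffact (real k) j) = (\<Sum>j\<in>{k}. (S j - T j) * ffact (real k) j)"
      proof (rule sum.mono_neutral_right)
        show "\<forall>j\<in>{..n} - {k}. (S j - T j) * ffact (real k) j = 0"
        proof
          fix j
          assume "j \<in> {..n} - {k}"
          then consider "j < k" | "k < j"
            by force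
          then show "(S j - T j) * ffact (real k) j = 0"
            by cases (simp_all add: less ffact_of_nat_eq_0)
        qed
      qed (use True in auto)
      with eq[of "real k"] ffact_of_nat_neq_0[of k] show ?thesis
        by simp
    next
      case False
      then show ?thesis
        using S T by (simp add: is_nc_stirling2_row_def)
    qed
  qed
qed

lemma is_nc_stirling2_row_ex1: "\<exists>!S. is_nc_stirling2_row n \<phi> S"
proof -
  have "\<exists>S. is_nc_stirling2_row n \<phi> S"
  proof (induction n)
    case 0
    have "is_nc_stirling2_row 0 \<phi> (\<lambda>k. if k = 0 then 1 else 0)"
      by (simp add: is_nc_stirling2_row_def ffact_def)
    then show ?case
      by blast
  qed (blast intro: is_nc_stirling2_row_Suc)
  then show ?thesis
    using is_nc_stirling2_row_unique by blast
qed

lemma is_nc_stirling2_row_nc_stirling2: "is_nc_stirling2_row n \<phi> (\<lambda>k. nc_stirling2 n k \<phi>)"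
  unfolding nc_stirling2_def using theI'[OF is_nc_stirling2_row_ex1] by simp

end

(* The binomial expansion of (exp t - 1)^k turns the explicit formula
   k! S(n,k,phi) = (sum over j <= k of (-1)^(k-j) binom(k,j) (phi+j)^n) into the exponential generating
   function of S(n,k,phi) in n, namely exp(phi t) (exp t - 1)^k / k!. With t = lambda theta / m and
   phi = m (1-theta)/theta, the Poisson mixture is exp(-lambda) (m)_k times this function, and
   exp(-lambda + phi t) = exp(-t)^m. *)

theory Submission
  imports Defs
begin

text \<open>Splitting one factor as \<open>\<phi> + j = (\<phi> + k) - (k - j)\<close> leaves
  \<open>D n k\<close> plus a remainder, which the absorption identity
  \<open>(k - j) * (k choose j) = k * (k - 1 choose j)\<close> reduces to
  \<open>D n (k - 1)\<close>.\<close>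

lemma sum_alternating_power_Suc:
  fixes \<phi> :: "'a::comm_ring_1"
  defines "D \<equiv> \<lambda>n k. \<Sum>j\<le>k. (-1) ^ (k - j) * of_nat (k choose j) * (\<phi> + of_nat j) ^ n"
  shows "D (Suc n) k = (\<phi> + of_nat k) * D n k + (case k of 0 \<Rightarrow> 0 | Suc i \<Rightarrow> of_nat k * D n i)"
proof (cases k)
  case 0
  then show ?thesis
    by (simp add: D_def)
next
  case (Suc i)
  let ?t = "\<lambda>k j. (-1) ^ (k - j) * of_nat (k choose j) * (\<phi> + of_nat j) ^ n"
  have step: "?t k j * of_nat (k - j) = - (of_nat k * ?t i j)" if "j \<le> i" for j
  proof -
    have "(k - j) * (k choose j) = k * (i choose j)"
      using binomial_absorb_comp[of k j] Suc by simp
    then have "of_nat (k - j) * of_nat (k choose j) = (of_nat k * of_nat (i choose j) :: 'a)"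
      by (metis of_nat_mult)
    \<comment> \<open>Lowering \<open>k\<close> to \<open>i\<close> flips the sign, so the
      subtracted remainder enters the recurrence with a plus.\<close>
    moreover have "(-1) ^ (k - j) = (- ((-1) ^ (i - j)) :: 'a)"
      using that Suc by (simp add: Suc_diff_le)
    moreover have "?t k j * of_nat (k - j)
        = (-1) ^ (k - j) * (of_nat (k - j) * of_nat (k choose j)) * (\<phi> + of_nat j) ^ n"
      by (simp add: mult_ac)
    ultimately show ?thesis
      by (simp add: mult_ac)
  qed
  have "D (Suc n) k = (\<Sum>j\<le>k. (\<phi> + of_nat k) * ?t k j - ?t k j * of_nat (k - j))"
    unfolding D_def by (intro sum.cong) (auto simp: of_nat_diff algebra_simps)
  also have "\<dots> = (\<phi> + of_nat k) * D n k - (\<Sum>j\<le>k. ?t k j * of_nat (k - j))"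
    by (simp add: D_def sum_subtractf sum_distrib_left)
  \<comment> \<open>The top term \<open>j = k\<close> carries the factor
    \<open>k - j = 0\<close>.\<close>
  also have "(\<Sum>j\<le>k. ?t k j * of_nat (k - j)) = (\<Sum>j\<le>i. ?t k j * of_nat (k - j))"
    by (simp add: Suc)
  also have "\<dots> = - (of_nat k * D n i)"
    by (simp add: step D_def sum_distrib_left sum_negf del: mult_minus_left)
  finally show ?thesis
    by (simp add: Suc)
qed

text \<open>Dividing the recurrence for the alternating sums by \<open>fact k\<close> cancels the
  factor \<open>k\<close> against \<open>fact k\<close>, which gives exactly the row recurrence of
  \<open>is_nc_stirling2_row_Suc\<close>.\<close>

lemma is_nc_stirling2_row_explicit:
  "is_nc_stirling2_row n \<phi>
     (\<lambda>k. (\<Sum>j\<le>k. (-1) ^ (k - j) * real (k choose j) * (\<phi> + real j) ^ n) / fact k)"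
proof (induction n)
  case 0
  \<comment> \<open>This is the expansion of \<open>(1 - 1) ^ k\<close>, with
    \<open>0 ^ 0 = 1\<close>.\<close>
  have "(\<Sum>j\<le>k. (-1) ^ (k - j) * real (k choose j)) = (if k = 0 then 1 else 0)" for k
    using binomial_ring[of "1::real" "-1" k] by (simp add: mult.commute power_0_left)
  then have "(\<Sum>j\<le>k. (-1) ^ (k - j) * real (k choose j) * (\<phi> + real j) ^ 0) / fact k
      = (if k = 0 then 1 else 0)" for k
    by simp
  then show ?case
    by (simp add: is_nc_stirling2_row_def ffact_def)
next
  case (Suc n)
  have "(\<Sum>j\<le>k. (-1) ^ (k - j) * real (k choose j) * (\<phi> + real j) ^ Suc n) / fact k
    = (\<phi> + real k) * ((\<Sum>j\<le>k. (-1) ^ (k - j) * real (k choose j) * (\<phi> + real j) ^ n) / fact k)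
      + (case k of 0 \<Rightarrow> 0 | Suc i \<Rightarrow>
          (\<Sum>j\<le>i. (-1) ^ (i - j) * real (i choose j) * (\<phi> + real j) ^ n) / fact i)" for k
    unfolding sum_alternating_power_Suc
    by (cases k) (simp_all add: add_divide_distrib del: of_nat_Suc sum.atMost_Suc)
  then show ?case
    using is_nc_stirling2_row_Suc[OF Suc] by presburger
qed

lemma nc_stirling2_explicit:
  "nc_stirling2 n k \<phi> =
     (\<Sum>j\<le>k. (-1) ^ (k - j) * real (k choose j) * (\<phi> + real j) ^ n) / fact k"
  using is_nc_stirling2_row_unique[OF is_nc_stirling2_row_nc_stirling2
      is_nc_stirling2_row_explicit]
  by (rule fun_cong)

lemma nc_stirling2_egf:
  "(\<lambda>n. nc_stirling2 n k \<phi> * t ^ n / fact n) sums (exp (\<phi> * t) * (exp t - 1) ^ k / fact k)"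
proof -
  let ?c = "\<lambda>j. (-1) ^ (k - j) * real (k choose j)"
  have exp_split: "exp ((\<phi> + real j) * t) = exp (\<phi> * t) * exp t ^ j" for j
    by (simp add: distrib_right exp_add exp_of_nat_mult)
  \<comment> \<open>The sum over \<open>j\<close> is finite, so the exponential series can be added
    termwise.\<close>
  have "(\<lambda>n. (\<Sum>j\<le>k. ?c j * (((\<phi> + real j) * t) ^ n /\<^sub>R fact n)) / fact k) sums
      ((\<Sum>j\<le>k. ?c j * exp ((\<phi> + real j) * t)) / fact k)"
    by (intro sums_divide sums_sum sums_mult exp_converges)
  also have "(\<lambda>n. (\<Sum>j\<le>k. ?c j * (((\<phi> + real j) * t) ^ n /\<^sub>R fact n)) / fact k)
      = (\<lambda>n. nc_stirling2 n k \<phi> * t ^ n / fact n)"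
    by (simp add: nc_stirling2_explicit power_mult_distrib sum_distrib_left sum_distrib_right
        divide_inverse mult_ac)
  also have "(\<Sum>j\<le>k. ?c j * exp ((\<phi> + real j) * t)) = exp (\<phi> * t) * (exp t - 1) ^ k"
    using binomial_ring[of "exp t" "-1" k] unfolding exp_split
    by (simp add: sum_distrib_left mult_ac)
  finally show ?thesis .
qed

lemma ffact_of_nat_eq_binomial: "ffact (real m) k = real (m choose k) * fact k"
  by (simp add: ffact_def binomial_gbinomial gbinomial_prod_rev atLeast0LessThan)

lemma poisson_occ_sums:
  assumes "m \<ge> 1" "0 < \<theta>" "\<theta> \<le> 1" "l > 0"
  shows "(\<lambda>r. pmf (poisson_pmf l) r * occ k r m \<theta>) sums
           pmf (binomial_pmf m (1 - exp (- (l * \<theta> / real m)))) k"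
proof -
  define t where "t = l * \<theta> / real m"
  define \<phi> where "\<phi> = real m * ((1 - \<theta>) / \<theta>)"
  have t: "t > 0"
    using assms by (simp add: t_def)
  have "\<phi> * t = l - real m * t"
    using assms by (simp add: \<phi>_def t_def field_simps)
  then have e: "exp (\<phi> * t) = exp l * exp (- t) ^ m"
    by (simp add: exp_diff exp_minus exp_of_nat_mult power_inverse divide_inverse)
  have "(\<lambda>r. exp (- l) * ffact (real m) k * (nc_stirling2 r k \<phi> * t ^ r / fact r)) sums
      (exp (- l) * ffact (real m) k * (exp (\<phi> * t) * (exp t - 1) ^ k / fact k))"
    by (intro sums_mult nc_stirling2_egf)
  \<comment> \<open>The factor \<open>l ^ r\<close> of the Poisson weight and
    \<open>\<theta> ^ r / real m ^ r\<close> from \<open>occ\<close> combine to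
    \<open>t ^ r\<close>.\<close>
  also have "(\<lambda>r. exp (- l) * ffact (real m) k * (nc_stirling2 r k \<phi> * t ^ r / fact r))
      = (\<lambda>r. pmf (poisson_pmf l) r * occ k r m \<theta>)"
    using assms
    by (simp add: occ_def t_def \<phi>_def power_mult_distrib power_divide mult_ac)
  also have "exp (- l) * ffact (real m) k * (exp (\<phi> * t) * (exp t - 1) ^ k / fact k)
      = real (m choose k) * (exp (- t) ^ m * (exp t - 1) ^ k)"
    by (simp add: e ffact_of_nat_eq_binomial exp_minus)
  \<comment> \<open>For \<open>k > m\<close> the truncated exponent \<open>m - k\<close> is
    harmless, since \<open>m choose k\<close> makes both sides zero.\<close>
  also have "\<dots> = real (m choose k) * (1 - exp (- t)) ^ k * exp (- t) ^ (m - k)"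
  proof (cases "k \<le> m")
    case True
    then have "exp (- t) ^ m = exp (- t) ^ k * exp (- t) ^ (m - k)"
      by (simp flip: power_add)
    moreover have "exp (- t) ^ k * (exp t - 1) ^ k = (1 - exp (- t)) ^ k"
      by (simp add: right_diff_distrib exp_minus flip: power_mult_distrib)
    ultimately show ?thesis
      by (metis mult.assoc mult.commute)
  qed simp
  \<comment> \<open>Positivity of \<open>t\<close> puts \<open>1 - exp (- t)\<close> in the unit
    interval, where \<open>binomial_pmf\<close> has its usual mass function.\<close>
  also have "\<dots> = pmf (binomial_pmf m (1 - exp (- t))) k"
    using t by simp
  finally show ?thesis
    by (simp add: t_def)
qed

theorem theorem13:
  fixes m k :: nat and \<theta> :: real
  assumes "m \<ge> 1" and "0 < \<theta>" and "\<theta> \<le> 1"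
  shows "(\<forall>l>0. (\<lambda>r. pmf (poisson_pmf l) r * occ k r m \<theta>) sums
            pmf (binomial_pmf m (1 - exp (- (l * \<theta> / real m)))) k) \<and>
         (\<forall>\<gamma>. 0 < \<gamma> \<and> \<gamma> < 1 \<longrightarrow>
            (\<lambda>r. pmf (poisson_pmf (real m * (\<bar>ln (1 - \<gamma>)\<bar> / \<theta>))) r * occ k r m \<theta>) sums
            pmf (binomial_pmf m \<gamma>) k)"
proof (intro conjI allI impI)
  fix \<gamma> :: real
  assume \<gamma>: "0 < \<gamma> \<and> \<gamma> < 1"
  \<comment> \<open>This \<open>l\<close> solves
    \<open>1 - exp (- (l * \<theta> / real m)) = \<gamma>\<close>, reducing the second form to the
    first.\<close>
  define l where "l = real m * (\<bar>ln (1 - \<gamma>)\<bar> / \<theta>)"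
  have "ln (1 - \<gamma>) < 0"
    using \<gamma> by simp
  then have "l > 0" and "l * \<theta> / real m = - ln (1 - \<gamma>)"
    using assms by (simp_all add: l_def divide_neg_pos mult_pos_neg)
  then show "(\<lambda>r. pmf (poisson_pmf l) r * occ k r m \<theta>) sums pmf (binomial_pmf m \<gamma>) k"
    using poisson_occ_sums[OF assms \<open>l > 0\<close>, of k] \<gamma> by simp
qed (rule poisson_occ_sums[OF assms])

end
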